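(* Let $F$ be a field of characteristic $0$. The general solution $\varphi\in F[x,y,z]$ of the linear partial differential equation $$-2y\,\varphi_x+z\,\varphi_y=0$$ has the form $\varphi=p(xz+y^2,z)$ with $p\in F[t_1,t_2]$. That is, a polynomial $\varphi\in F[x,y,z]$ satisfies $-2y\varphi_x+z\varphi_y=0$ if and only if there exists $p\in F[t_1,t_2]$ such that $\varphi=p(xz+y^2,z)$.
   Context: $\varphi_x,\varphi_y$ denote the formal partial derivatives of $\varphi$ with respect to $x$ and $y$. $F[t_1,t_2]$ is the polynomial ring in two variables. *)

theory Defs
  imports "HOL-Computational_Algebra.Polynomial"
begin

text \<open>
  Iterated univariate polynomials encode several variables, the last variable being the main one:
  \<open>F[x,y,z]\<close> is \<open>F[x][y][z]\<close>, of type \<open>'a poly poly poly\<close>, and \<open>F[t1,t2]\<close> is \<open>F[t1][t2]\<close>, of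
  type \<open>'a poly poly\<close>. So \<open>coeff (coeff (coeff f k) j) i\<close> is the coefficient of
  \<open>x^i * y^j * z^k\<close> in \<open>f\<close>.
\<close>

definition var_x :: "'a::comm_ring_1 poly poly poly"
  where "var_x = [:[:[:0, 1:]:]:]"

definition var_y :: "'a::comm_ring_1 poly poly poly"
  where "var_y = [:[:0, 1:]:]"

definition var_z :: "'a::comm_ring_1 poly poly poly"
  where "var_z = [:0, 1:]"

definition const3 :: "'a::comm_ring_1 \<Rightarrow> 'a poly poly poly"
  where "const3 c = [:[:[:c:]:]:]"

definition diff_x :: "'a::idom poly poly poly \<Rightarrow> 'a poly poly poly"
  where "diff_x = map_poly (map_poly pderiv)"

definition diff_y :: "'a::idom poly poly poly \<Rightarrow> 'a poly poly poly"
  where "diff_y = map_poly pderiv"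

text \<open>\<open>subst2 p u v\<close> is \<open>p(u,v)\<close>: the inner variable \<open>t1\<close> is replaced by \<open>u\<close>, the outer one,
  \<open>t2\<close>, by \<open>v\<close>.\<close>

definition subst2 ::
    "'a::comm_ring_1 poly poly \<Rightarrow> 'a poly poly poly \<Rightarrow> 'a poly poly poly \<Rightarrow> 'a poly poly poly"
  where "subst2 p u v = poly (map_poly (\<lambda>q. poly (map_poly const3 q) u) p) v"

lemma coeff_diff_x:
  "coeff (coeff (coeff (diff_x f) k) j) i = of_nat (Suc i) * coeff (coeff (coeff f k) j) (Suc i)"
  by (simp add: diff_x_def coeff_map_poly coeff_pderiv)

lemma coeff_diff_y:
  "coeff (coeff (coeff (diff_y f) k) j) i = of_nat (Suc j) * coeff (coeff (coeff f k) (Suc j)) i"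
  by (simp add: diff_y_def coeff_map_poly coeff_pderiv of_nat_poly del: of_nat_Suc)

lemma subst2_altdef:
  "subst2 p u v =
     (\<Sum>k\<le>degree p. \<Sum>i\<le>degree (coeff p k). const3 (coeff (coeff p k) i) * u ^ i * v ^ k)"
proof -
  have aux: "poly (map_poly f q) w = (\<Sum>i\<le>degree q. f (coeff q i) * w ^ i)"
    if "f 0 = 0" for f :: "'b::comm_ring_1 \<Rightarrow> 'c::comm_ring_1" and q w
  proof -
    have "poly (map_poly f q) w = (\<Sum>i\<le>degree (map_poly f q). f (coeff q i) * w ^ i)"
      using that by (simp add: poly_altdef coeff_map_poly)
    also have "\<dots> = (\<Sum>i\<le>degree q. f (coeff q i) * w ^ i)"
    proof (rule sum.mono_neutral_left)
      show "{..degree (map_poly f q)} \<subseteq> {..degree q}"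
        using map_poly_degree_leq[of f q] that by simp
      show "\<forall>i\<in>{..degree q} - {..degree (map_poly f q)}. f (coeff q i) * w ^ i = 0"
        using that coeff_eq_0[of "map_poly f q"] by (auto simp: coeff_map_poly)
    qed simp
    finally show ?thesis .
  qed
  have "const3 (0::'a) = 0"
    by (simp add: const3_def)
  then show ?thesis
    by (simp add: subst2_def aux sum_distrib_right)
qed

end

theory Submission
  imports Defs
begin

text \<open>
  Let \<open>D = -2y \<partial>\<^sub>x + z \<partial>\<^sub>y\<close>. It is a derivation killing \<open>xz + y\<^sup>2\<close>, \<open>z\<close> and constants, hence every
  \<open>p(xz + y\<^sup>2, z)\<close>. Conversely, comparing coefficients in \<open>D \<phi> = 0\<close> shows that \<open>\<phi>\<close> is determined
  by \<open>\<phi>(0,y,z)\<close> and is even in \<open>y\<close>. Thus \<open>\<phi>(0,y,z) = p(y\<^sup>2,z)\<close> for some \<open>p\<close>, and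
  \<open>p(xz + y\<^sup>2, z)\<close>, which is also killed by \<open>D\<close> and agrees with \<open>\<phi>\<close> at \<open>x = 0\<close>, equals \<open>\<phi>\<close>.
\<close>

definition pde_op :: "'a::idom poly poly poly \<Rightarrow> 'a poly poly poly"
  where "pde_op f = - 2 * var_y * diff_x f + var_z * diff_y f"

definition inv_u :: "'a::comm_ring_1 poly poly poly"
  where "inv_u = var_x * var_z + var_y ^ 2"

lemma poly3_eqI:
  assumes "\<And>i j k. coeff (coeff (coeff f k) j) i = coeff (coeff (coeff g k) j) i"
  shows "f = g"
  using assms by (simp add: poly_eq_iff)

lemma coeff_var_x_mult:
  "coeff (coeff (coeff (var_x * f) k) j) i =
     (case i of 0 \<Rightarrow> 0 | Suc i' \<Rightarrow> coeff (coeff (coeff f k) j) i')"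
  by (simp add: var_x_def coeff_pCons split: nat.split)

lemma coeff_var_y_mult:
  "coeff (coeff (var_y * f) k) j = (case j of 0 \<Rightarrow> 0 | Suc j' \<Rightarrow> coeff (coeff f k) j')"
  by (simp add: var_y_def coeff_pCons split: nat.split)

lemma coeff_var_z_mult:
  "coeff (var_z * f) k = (case k of 0 \<Rightarrow> 0 | Suc k' \<Rightarrow> coeff f k')"
  by (simp add: var_z_def coeff_pCons split: nat.split)

lemma coeff_const3_mult:
  "coeff (coeff (coeff (const3 c * f) k) j) i = c * coeff (coeff (coeff f k) j) i"
  by (simp add: const3_def)

text \<open>Turns the equation into a recurrence between coefficients. Each boundary case leaves a
  single term: only the x-derivative contributes at z^0, and only the y-derivative at y^0.\<close>

lemma coeff_pde_op:
  "coeff (coeff (coeff (pde_op f) k) j) i =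
     (case k of 0 \<Rightarrow> 0 | Suc k' \<Rightarrow> of_nat (Suc j) * coeff (coeff (coeff f k') (Suc j)) i)
     - (case j of 0 \<Rightarrow> 0 | Suc j' \<Rightarrow> 2 * of_nat (Suc i) * coeff (coeff (coeff f k) j') (Suc i))"
proof -
  have "pde_op f = var_z * diff_y f - (var_y * diff_x f + var_y * diff_x f)"
    by (simp add: pde_op_def algebra_simps)
  then show ?thesis
    by (simp only: coeff_diff coeff_add coeff_var_y_mult coeff_var_z_mult)
       (simp add: coeff_diff_x coeff_diff_y algebra_simps del: of_nat_Suc split: nat.split)
qed

lemma map_poly_derivation_add:
  assumes "d 0 = 0" "\<And>a b. d (a + b) = d a + d b"
  shows "map_poly d (f + g) = map_poly d f + map_poly d g"
  using assms by (simp add: poly_eq_iff coeff_map_poly)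

text \<open>Leibniz' rule passes through the convolution sum, so a derivation applied
  coefficientwise is again a derivation; \<open>diff_x\<close> nests this twice.\<close>

lemma map_poly_derivation_mult:
  fixes d :: "'a::comm_ring_1 \<Rightarrow> 'a"
  assumes "d 0 = 0" "\<And>a b. d (a + b) = d a + d b" "\<And>a b. d (a * b) = d a * b + a * d b"
  shows "map_poly d (f * g) = map_poly d f * g + f * map_poly d g"
proof (rule poly_eqI)
  fix n
  have sum: "d (sum h A) = (\<Sum>x\<in>A. d (h x))" for h :: "nat \<Rightarrow> 'a" and A
    using assms(1,2) by (induction A rule: infinite_finite_induct) auto
  show "coeff (map_poly d (f * g)) n = coeff (map_poly d f * g + f * map_poly d g) n"
    using assms by (simp add: coeff_map_poly coeff_mult sum sum.distrib)
qed

lemma diff_x_mult: "diff_x (f * g) = diff_x f * g + f * diff_x g"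
  unfolding diff_x_def
  by (intro map_poly_derivation_mult map_poly_derivation_add)
     (simp_all add: pderiv_add pderiv_mult algebra_simps)

lemma diff_y_mult: "diff_y (f * g) = diff_y f * g + f * diff_y g"
  unfolding diff_y_def
  by (intro map_poly_derivation_mult) (simp_all add: pderiv_add pderiv_mult algebra_simps)

lemma pde_op_0 [simp]: "pde_op 0 = 0"
  by (simp add: pde_op_def diff_x_def diff_y_def)

lemma pde_op_add: "pde_op (f + g) = pde_op f + pde_op g"
  by (rule poly3_eqI) (simp add: coeff_pde_op algebra_simps split: nat.split)

lemma pde_op_diff: "pde_op (f - g) = pde_op f - pde_op g"
  using pde_op_add[of "f - g" g] by simp

lemma pde_op_mult: "pde_op (f * g) = pde_op f * g + f * pde_op g"
  by (simp add: pde_op_def diff_x_mult diff_y_mult algebra_simps)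

lemma pde_op_sum: "pde_op (sum h A) = (\<Sum>x\<in>A. pde_op (h x))"
  by (induction A rule: infinite_finite_induct) (auto simp: pde_op_add)

lemma pde_op_const3: "pde_op (const3 c) = 0"
  by (simp add: pde_op_def const3_def diff_x_def diff_y_def map_poly_pCons)

lemma map_poly_pderiv_1: "map_poly pderiv 1 = 0"
  by (simp add: one_pCons map_poly_pCons)

lemma pde_op_var_x: "pde_op var_x = - 2 * var_y"
  by (simp add: pde_op_def var_x_def diff_x_def diff_y_def map_poly_pCons pderiv_pCons
      map_poly_pderiv_1 flip: one_pCons)

lemma pde_op_var_y: "pde_op var_y = var_z"
  by (simp add: pde_op_def var_y_def diff_x_def diff_y_def map_poly_pCons pderiv_pCons
      map_poly_pderiv_1 flip: one_pCons)

lemma pde_op_var_z: "pde_op var_z = 0"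
  by (simp add: pde_op_def var_z_def diff_x_def diff_y_def map_poly_pCons pderiv_pCons
      map_poly_pderiv_1)

lemma pde_op_inv_u: "pde_op inv_u = 0"
  by (simp add: inv_u_def power2_eq_square pde_op_add pde_op_mult pde_op_var_x pde_op_var_y
      pde_op_var_z algebra_simps)

lemma pde_op_power:
  assumes "pde_op f = 0"
  shows "pde_op (f ^ n) = 0"
proof (induction n)
  case 0
  show ?case
    using pde_op_const3[of 1] by (simp add: const3_def flip: one_pCons)
next
  case (Suc n)
  then show ?case
    by (simp add: pde_op_mult assms)
qed

lemma pde_op_subst2: "pde_op (subst2 p inv_u var_z) = 0"
  by (simp add: subst2_altdef pde_op_sum pde_op_mult pde_op_const3 pde_op_power pde_op_inv_u
      pde_op_var_z)

text \<open>Read from right to left, this lowers the exponent of x by one, which serves uniqueness;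
  read from left to right, it lowers that of y by two, which serves parity.\<close>

lemma pde_op_kernel_step:
  assumes "pde_op f = 0"
  shows "of_nat (Suc (Suc j)) * coeff (coeff (coeff f k) (Suc (Suc j))) i =
    2 * of_nat (Suc i) * coeff (coeff (coeff f (Suc k)) j) (Suc i)"
  using coeff_pde_op[of f "Suc k" "Suc j" i] assms by (simp del: of_nat_Suc)

text \<open>In characteristic 0 the factor \<open>2 * of_nat (Suc i)\<close> can be cancelled, so
  vanishing at x^i propagates to x^(i+1).\<close>

lemma pde_op_kernel_eqI:
  fixes f g :: "'a::field_char_0 poly poly poly"
  assumes "pde_op f = 0" "pde_op g = 0"
    and eq0: "\<And>j k. coeff (coeff (coeff f k) j) 0 = coeff (coeff (coeff g k) j) 0"
  shows "f = g"
proof -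
  define h where "h = f - g"
  have h: "pde_op h = 0"
    using assms by (simp add: h_def pde_op_diff)
  have "coeff (coeff (coeff h k) j) i = 0" for i j k
  proof (induction i arbitrary: j k)
    case 0
    show ?case
      using eq0 by (simp add: h_def)
  next
    case (Suc i)
    show ?case
    proof (cases k)
      case 0
      \<comment> \<open>At z^0 the recurrence has no y-derivative term; the index
        \<open>Suc j\<close> offsets the factor y.\<close>
      then show ?thesis
        using coeff_pde_op[of h 0 "Suc j" i] h by (simp del: of_nat_Suc)
    next
      case (Suc k')
      then show ?thesis
        using pde_op_kernel_step[OF h, of j k' i] Suc.IH by (simp del: of_nat_Suc)
    qed
  qed
  then have "h = 0"
    by (intro poly3_eqI) simp
  then show ?thesis
    by (simp add: h_def)
qed

lemma pde_op_kernel_even: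
  fixes f :: "'a::field_char_0 poly poly poly"
  assumes "pde_op f = 0" "odd j"
  shows "coeff (coeff (coeff f k) j) i = 0"
  using assms(2)
proof (induction j arbitrary: i k rule: induct_nat_012)
  case 1
  show ?case
    \<comment> \<open>At y^0 the x-derivative term is absent, so the coefficient of y^1 vanishes;
      \<open>Suc k\<close> offsets the factor z.\<close>
    using coeff_pde_op[of f "Suc k" 0 i] assms(1) by simp
next
  case (ge2 j)
  then show ?case
    using pde_op_kernel_step[OF assms(1), of j k i] by (simp del: of_nat_Suc)
qed simp

text \<open>At x = 0 the polynomial xz + y^2 becomes y^2.\<close>

lemma coeff_inv_u_power:
  "coeff (coeff (coeff ((inv_u :: 'a::comm_ring_1 poly poly poly) ^ n) k) j) 0 = (if k = 0 \<and> j = 2 * n then 1 else 0)"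
proof (induction n arbitrary: j k)
  case 0
  show ?case
    by (auto simp: coeff_1)
next
  case (Suc n)
  have "(inv_u :: 'a poly poly poly) ^ Suc n = var_x * (var_z * inv_u ^ n) + var_y * (var_y * inv_u ^ n)"
    by (simp add: inv_u_def power2_eq_square algebra_simps)
  then show ?case
    by (auto simp: coeff_var_x_mult coeff_var_y_mult Suc.IH simp del: power_Suc split: nat.split)
qed

lemma coeff_mult_var_z_power:
  "coeff (f * var_z ^ n) k = (if n \<le> k then coeff f (k - n) else 0)"
proof (induction n arbitrary: k)
  case (Suc n)
  have "f * var_z ^ Suc n = var_z * (f * var_z ^ n)"
    by (simp add: mult_ac)
  then show ?case
    by (auto simp: coeff_var_z_mult Suc.IH simp del: power_Suc split: nat.split)
qed simp

lemma coeff_subst2_at_0: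
  "coeff (coeff (coeff (subst2 p inv_u var_z) k) j) 0 =
     (if even j then coeff (coeff p k) (j div 2) else 0)"
proof -
  have summand: "coeff (coeff (coeff (const3 c * inv_u ^ i * var_z ^ l) k) j) 0 =
      (if l = k then if j = 2 * i then c else 0 else 0)" for c :: 'a and i l
    by (auto simp: mult.assoc coeff_const3_mult coeff_mult_var_z_power coeff_inv_u_power)
  have inner: "(\<Sum>i\<le>degree q. if j = 2 * i then coeff q i else 0) =
      (if even j then coeff q (j div 2) else 0)" for q :: "'a poly"
  proof (cases "even j")
    case True
    then have "j = 2 * i \<longleftrightarrow> i = j div 2" for i
      by auto
    then show ?thesis
      \<comment> \<open>If \<open>j div 2\<close> exceeds \<open>degree q\<close>, no summand
        matches and the coefficient is 0 as well.\<close>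
      using True by (simp add: coeff_eq_0)
  qed (auto intro!: sum.neutral)
  have "coeff (coeff (coeff (subst2 p inv_u var_z) k) j) 0 =
      (\<Sum>l\<le>degree p. \<Sum>i\<le>degree (coeff p l).
        if l = k then if j = 2 * i then coeff (coeff p l) i else 0 else 0)"
    by (simp only: subst2_altdef coeff_sum summand)
  also have "\<dots> = (\<Sum>l\<le>degree p. if l = k then if even j then coeff (coeff p l) (j div 2) else 0 else 0)"
    by (intro sum.cong) (auto simp: inner)
  also have "\<dots> = (if even j then coeff (coeff p k) (j div 2) else 0)"
    by (simp add: coeff_eq_0)
  finally show ?thesis .
qed

text \<open>A left inverse of the substitution sending q(t) to q(t^2).\<close>

definition even_part :: "'a::zero poly \<Rightarrow> 'a poly"
  where "even_part q = Abs_poly (\<lambda>i. coeff q (2 * i))"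

lemma coeff_even_part: "coeff (even_part q) i = coeff q (2 * i)"
  unfolding even_part_def by (subst coeff_Abs_poly[of "degree q"]) (simp_all add: coeff_eq_0)

theorem theorem1:
  fixes \<phi> :: "'a::field_char_0 poly poly poly"
  shows "- 2 * var_y * diff_x \<phi> + var_z * diff_y \<phi> = 0 \<longleftrightarrow>
    (\<exists>p :: 'a poly poly. \<phi> = subst2 p (var_x * var_z + var_y ^ 2) var_z)"
  unfolding pde_op_def[symmetric] inv_u_def[symmetric]
proof
  assume \<phi>: "pde_op \<phi> = 0"
  \<comment> \<open>The innermost map sets x = 0, \<open>even_part\<close> turns y^2 into t1, and
    the outer variable z becomes t2.\<close>
  define p where "p = map_poly (\<lambda>q. even_part (map_poly (\<lambda>r. coeff r 0) q)) \<phi>"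
  have "even_part 0 = (0 :: 'a poly)"
    by (simp add: poly_eq_iff coeff_even_part)
  then have p: "coeff (coeff p k) i = coeff (coeff (coeff \<phi> k) (2 * i)) 0" for k i
    by (simp add: p_def coeff_map_poly coeff_even_part)
  have "\<phi> = subst2 p inv_u var_z"
    \<comment> \<open>At x = 0 the coefficients agree for even \<open>j\<close> by the choice of
      \<open>p\<close>; for odd \<open>j\<close> both are 0, on the side of \<phi> by
      parity.\<close>
    by (rule pde_op_kernel_eqI[OF \<phi> pde_op_subst2])
       (simp add: coeff_subst2_at_0 p pde_op_kernel_even[OF \<phi>])
  then show "\<exists>p. \<phi> = subst2 p inv_u var_z" ..
next
  assume "\<exists>p. \<phi> = subst2 p inv_u var_z"
  then show "pde_op \<phi> = 0"
    by (auto simp: pde_op_subst2)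
qed

end
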